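(* Let $p\geq 3$ be a prime. Suppose that an integer $n$ cannot be represented as the sum of an integer in $\mathcal{M}_p$ and at most $p-2$ powers of $p$. Then, for every integer $a\geq 0$, the integer $p^a n$ also cannot be represented as the sum of an integer in $\mathcal{M}_p$ and at most $p-2$ powers of $p$.
   Context: For a prime $p\ge 3$, $\mathcal{M}_p$ denotes the set of positive integers that are norms of ideals of $\mathbb{Z}[\exp(2\pi i/p)]$, where the norm of a nonzero ideal $I$ is the index $|\mathbb{Z}[\exp(2\pi i/p)]/I|$. A power of $p$ means $p^b$ with $b\geq 0$ an integer (so $1$ is a power of $p$). An integer $n$ is the sum of an integer in $\mathcal{M}_p$ and at most $p-2$ powers of $p$ if $n=m+p^{b_1}+\cdots+p^{b_j}$ for some $m\in\mathcal{M}_p$, some $0\le j\le p-2$ and some integers $b_1,\dots,b_j\ge 0$, not necessarily distinct. *)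

theory Defs
  imports Complex_Main "HOL-Algebra.QuotRing" "HOL-Computational_Algebra.Polynomial"
    "HOL-Computational_Algebra.Primes"
begin

definition cyclotomic_root :: "nat \<Rightarrow> complex" where
  "cyclotomic_root p = exp (2 * of_real pi * \<i> / of_nat p)"

definition cyclotomic_ring :: "nat \<Rightarrow> complex ring" where
  "cyclotomic_ring p =
     \<lparr>carrier = range (\<lambda>f :: int poly. poly (map_poly of_int f) (cyclotomic_root p)),
      monoid.mult = (*), one = 1, zero = 0, add = (+)\<rparr>"

lemma cyclotomic_ring_simps [simp]:
  "monoid.mult (cyclotomic_ring p) = (*)"
  "one (cyclotomic_ring p) = 1"
  "zero (cyclotomic_ring p) = 0"
  "add (cyclotomic_ring p) = (+)"
  by (simp_all add: cyclotomic_ring_def)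

lemma carrier_cyclotomic_ring:
  "carrier (cyclotomic_ring p) =
     range (\<lambda>f :: int poly. poly (map_poly of_int f) (cyclotomic_root p))"
  by (simp add: cyclotomic_ring_def)

lemma cring_cyclotomic_ring: "cring (cyclotomic_ring p)"
proof -
  let ?e = "\<lambda>f :: int poly. poly (map_poly of_int f) (cyclotomic_root p)"
  have "map_poly of_int (f + g) = map_poly of_int f + (map_poly of_int g :: complex poly)"
    and "map_poly of_int (f * g) = map_poly of_int f * (map_poly of_int g :: complex poly)"
    and "map_poly of_int (- f) = - (map_poly of_int f :: complex poly)" for f g :: "int poly"
    by (rule poly_eqI, simp add: coeff_map_poly coeff_mult)+
  then have add: "?e f + ?e g = ?e (f + g)" and mult: "?e f * ?e g = ?e (f * g)"
    and uminus: "- ?e f = ?e (- f)" for f g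
    by simp_all
  have zero: "0 \<in> range ?e" and one: "1 \<in> range ?e"
    by (rule range_eqI[of _ _ 0], simp) (rule range_eqI[of _ _ 1], simp)
  show ?thesis
  proof (rule cringI)
    show "abelian_group (cyclotomic_ring p)"
    proof (rule abelian_groupI)
      show "\<exists>y\<in>carrier (cyclotomic_ring p). y \<oplus>\<^bsub>cyclotomic_ring p\<^esub> x = \<zero>\<^bsub>cyclotomic_ring p\<^esub>"
        if "x \<in> carrier (cyclotomic_ring p)" for x
        using that uminus by (intro bexI[of _ "- x"]) (auto simp: carrier_cyclotomic_ring)
    qed (use zero in \<open>auto simp: carrier_cyclotomic_ring add\<close>)
    show "comm_monoid (cyclotomic_ring p)"
      by (rule comm_monoidI) (use one in \<open>auto simp: carrier_cyclotomic_ring mult\<close>)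
  qed (simp add: algebra_simps)
qed

text \<open>The index is positive exactly when it is finite, because \<^const>\<open>card\<close> of an infinite set is 0.\<close>

definition ideal_norms :: "nat \<Rightarrow> nat set" where
  "ideal_norms p =
     {m. m > 0 \<and> (\<exists>I. ideal I (cyclotomic_ring p) \<and> I \<noteq> {0} \<and>
                      m = Coset.order (cyclotomic_ring p Quot I))}"

definition sum_norm_and_powers :: "nat \<Rightarrow> int \<Rightarrow> bool" where
  "sum_norm_and_powers p n \<longleftrightarrow>
     (\<exists>m \<in> ideal_norms p. \<exists>bs :: nat list.
        length bs \<le> p - 2 \<and> n = int m + (\<Sum>b\<leftarrow>bs. int p ^ b))"

end

theory Submission
  imports Defs "HOL-Number_Theory.Cong"
begin

text \<open>
  Let \<open>\<zeta>\<close> be the root of unity, \<open>\<lambda> = 1 - \<zeta>\<close>, and let \<open>I\<close> be an ideal of finite index \<open>m\<close>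
  in \<open>\<O> = \<int>[\<zeta>]\<close>. Multiplication by \<open>\<zeta>\<close> permutes \<open>\<O>/I\<close> with period \<open>p\<close>, so \<open>m\<close> is congruent
  modulo \<open>p\<close> to its number of fixed points, which are the classes killed by \<open>\<lambda>\<close>. If only the zero
  class is fixed, then \<open>m \<equiv> 1\<close> modulo \<open>p\<close>. Otherwise \<open>\<lambda>\<close> is not invertible modulo \<open>I\<close>; as
  \<open>\<O>/\<lambda>\<O>\<close> is a quotient of \<open>\<int>/p\<close>, this forces \<open>I \<subseteq> \<lambda>\<O>\<close>, so that \<open>I = \<lambda>J\<close> and \<open>m = p [\<O> : J]\<close>.
  In a representation of \<open>p n\<close> with at most \<open>p - 2\<close> powers, reduction modulo \<open>p\<close> excludes the first
  case and all summands \<open>p\<^sup>0\<close>, so the whole representation can be divided by \<open>p\<close>.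
\<close>

section \<open>Orbits of a map whose iterates have prime period\<close>

text \<open>A coincidence in the orbit makes \<open>x\<close> fixed by \<open>f ^^ d\<close> with
  \<open>d\<close> coprime to \<open>p\<close>. Iterating that \<open>u\<close> times, with
  \<open>u\<close> inverse to \<open>d\<close> modulo \<open>p\<close>, would make \<open>x\<close>
  a fixed point of \<open>f\<close>.\<close>

lemma inj_on_funpow_orbit:
  assumes "prime p" "(f ^^ p) x = x" "f x \<noteq> x"
  shows "inj_on (\<lambda>i. (f ^^ i) x) {..<p}"
proof (rule linorder_inj_onI')
  fix i j assume "i \<in> {..<p}" "j \<in> {..<p}" "i < j"
  \<comment> \<open>The iterate \<open>f ^^ i\<close> is not cancelled but completed to a full
    period by \<open>f ^^ (p - i)\<close>; so \<open>d\<close> is \<open>j - i\<close> shifted by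
    \<open>p\<close>.\<close>
  define d where "d = j + (p - i)"
  show "(f ^^ i) x \<noteq> (f ^^ j) x"
  proof
    assume "(f ^^ i) x = (f ^^ j) x"
    then have "(f ^^ d) x = (f ^^ (p - i)) ((f ^^ i) x)"
      by (metis add.commute comp_apply d_def funpow_add)
    also have "\<dots> = (f ^^ p) x"
      using \<open>i \<in> {..<p}\<close> by (metis comp_apply funpow_add lessThan_iff less_imp_le le_add_diff_inverse2)
    finally have d: "(f ^^ d) x = x" using assms(2) by simp
    have "\<not> p dvd j - i"
      using \<open>j \<in> {..<p}\<close> \<open>i < j\<close> by (auto dest: dvd_imp_le)
    moreover have "d = p + (j - i)"
      using \<open>i \<in> {..<p}\<close> \<open>i < j\<close> by (simp add: d_def)
    ultimately have "coprime d p"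
      using assms(1) by (metis coprime_commute dvd_add_right_iff dvd_refl prime_imp_coprime)
    then obtain u where u: "[d * u = 1] (mod p)"
      using cong_solve_coprime_nat by auto
    have "((f ^^ d) ^^ u) x = x"
      by (induction u) (simp_all add: d)
    then have "(f ^^ (d * u)) x = x"
      by (simp add: funpow_mult mult.commute)
    then have "x = (f ^^ (d * u mod p)) x"
      using funpow_mod_eq[OF assms(2)] by simp
    also have "d * u mod p = 1"
      using u prime_gt_1_nat[OF assms(1)] by (simp add: cong_def)
    finally show False using assms(3) by simp
  qed
qed

text \<open>The orbits of non-fixed points partition them into blocks of exactly \<open>p\<close>
  elements.\<close>

lemma prime_dvd_card_non_fixpoints:
  assumes "prime p" "finite S" "f ` S \<subseteq> S" "\<And>x. x \<in> S \<Longrightarrow> (f ^^ p) x = x"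
  shows "p dvd card {x \<in> S. f x \<noteq> x}"
proof -
  define N where "N = {x \<in> S. f x \<noteq> x}"
  define orb where "orb x = (\<lambda>i. (f ^^ i) x) ` {..<p}" for x
  have "p > 0" using assms(1) prime_gt_0_nat by blast
  have S: "(f ^^ i) x \<in> S" if "x \<in> S" for i x
    using that assms(3) by (induction i) auto
  have all: "(f ^^ i) x \<in> orb x" if "x \<in> S" for i x
  proof -
    have "(f ^^ i) x = (f ^^ (i mod p)) x"
      using funpow_mod_eq[OF assms(4)[OF that]] by simp
    then show ?thesis using \<open>p > 0\<close> by (auto simp: orb_def)
  qed
  \<comment> \<open>Periodicity supplies a left inverse of \<open>f ^^ i\<close> on
    \<open>S\<close>.\<close>
  have turn: "(f ^^ (p - i)) ((f ^^ i) x) = x" if "x \<in> S" "i < p" for i x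
    using assms(4)[OF that(1)] that(2)
    by (metis comp_apply funpow_add less_imp_le le_add_diff_inverse2)
  have sub: "orb x \<subseteq> N" if "x \<in> N" for x
  proof
    fix y assume "y \<in> orb x"
    then obtain i where i: "i < p" "y = (f ^^ i) x" by (auto simp: orb_def)
    have x: "x \<in> S" "f x \<noteq> x" using that by (auto simp: N_def)
    have "f y \<noteq> y"
    proof
      assume "f y = y"
      then have "(f ^^ k) y = y" for k by (induction k) auto
      then show False using turn[OF x(1) i(1)] \<open>f y = y\<close> x(2) i(2) by metis
    qed
    then show "y \<in> N" using S[OF x(1)] i(2) by (simp add: N_def)
  qed
  have eq: "orb y = orb x" if "x \<in> S" "y \<in> orb x" for x y
  proof -
    from that(2) obtain i where i: "i < p" "y = (f ^^ i) x" by (auto simp: orb_def)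
    have "y \<in> S" using S that(1) i(2) by simp
    have "orb y \<subseteq> orb x"
    proof
      fix w assume "w \<in> orb y"
      then obtain k where "w = (f ^^ k) y" by (auto simp: orb_def)
      then have "w = (f ^^ (k + i)) x" using i(2) by (simp add: funpow_add)
      then show "w \<in> orb x" using all[OF that(1)] by simp
    qed
    moreover have "orb x \<subseteq> orb y"
    proof
      fix w assume "w \<in> orb x"
      then obtain k where "w = (f ^^ k) x" by (auto simp: orb_def)
      then have "w = (f ^^ (k + (p - i))) y"
        using turn[OF that(1) i(1)] i(2) by (simp add: funpow_add)
      then show "w \<in> orb y" using all[OF \<open>y \<in> S\<close>] by simp
    qed
    ultimately show ?thesis by blast
  qed
  have un: "\<Union> (orb ` N) = N"
    using sub all[of _ 0] by (fastforce simp: N_def)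
  have "p dvd card (\<Union> (orb ` N))"
  proof (rule dvd_partition)
    show "finite (\<Union> (orb ` N))" using un assms(2) by (simp add: N_def)
    show "\<forall>c\<in>orb ` N. p dvd card c"
      using inj_on_funpow_orbit[OF assms(1) assms(4)]
      by (auto simp: N_def orb_def card_image)
    show "\<forall>c1\<in>orb ` N. \<forall>c2\<in>orb ` N. c1 \<noteq> c2 \<longrightarrow> c1 \<inter> c2 = {}"
    proof (intro ballI impI)
      fix c1 c2 assume "c1 \<in> orb ` N" "c2 \<in> orb ` N" "c1 \<noteq> c2"
      then obtain x y where "x \<in> S" "y \<in> S" "c1 = orb x" "c2 = orb y" by (auto simp: N_def)
      then show "c1 \<inter> c2 = {}" using eq \<open>c1 \<noteq> c2\<close> by blast
    qed
  qed
  then show ?thesis unfolding un by (simp add: N_def)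
qed

section \<open>Arithmetic modulo \<open>1 - \<zeta>\<close>\<close>

locale prime_cyclotomic =
  fixes p :: nat
  assumes prime: "prime p"
begin

abbreviation \<zeta> :: complex where "\<zeta> \<equiv> cyclotomic_root p"
abbreviation \<O> :: "complex set" where "\<O> \<equiv> carrier (cyclotomic_ring p)"

text \<open>An additive coset in plain complex arithmetic, defined for every complex
  \<open>x\<close>, so that coset identities carry no membership conditions.\<close>

definition coset :: "complex set \<Rightarrow> complex \<Rightarrow> complex set" where
  "coset I x = (\<lambda>h. h + x) ` I"

lemma root_pow: "\<zeta> ^ p = 1"
  using prime_gt_0_nat[OF prime] by (simp add: cyclotomic_root_def flip: exp_of_nat_mult)

lemma root_neq_1: "\<zeta> \<noteq> 1"
proof -
  have "cos (2 * pi / real p) < cos 0"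
    using prime_ge_2_nat[OF prime] by (intro cos_monotone_0_pi) (auto simp: field_simps)
  moreover have "Re \<zeta> = cos (2 * pi / real p)"
    by (simp add: cyclotomic_root_def Re_exp)
  ultimately show ?thesis by auto
qed

lemma of_int_mem: "of_int c \<in> \<O>"
  unfolding carrier_cyclotomic_ring by (rule range_eqI[of _ _ "[:c:]"]) (simp add: map_poly_pCons)

lemma root_mem: "\<zeta> \<in> \<O>"
  unfolding carrier_cyclotomic_ring by (rule range_eqI[of _ _ "[:0, 1:]"]) (simp add: map_poly_pCons)

lemma add_mem: "x \<in> \<O> \<Longrightarrow> y \<in> \<O> \<Longrightarrow> x + y \<in> \<O>"
  using ring.ring_simprules(1)[OF cring.axioms(1)[OF cring_cyclotomic_ring]] by simp

lemma mult_mem: "x \<in> \<O> \<Longrightarrow> y \<in> \<O> \<Longrightarrow> x * y \<in> \<O>"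
  using ring.ring_simprules(5)[OF cring.axioms(1)[OF cring_cyclotomic_ring]] by simp

lemma diff_mem: "x \<in> \<O> \<Longrightarrow> y \<in> \<O> \<Longrightarrow> x - y \<in> \<O>"
  using add_mem[of x "of_int (- 1) * y"] mult_mem[OF of_int_mem[of "- 1"], of y] by simp

lemma one_mem: "1 \<in> \<O>"
  using of_int_mem[of 1] by simp

lemma power_mem: "x \<in> \<O> \<Longrightarrow> x ^ k \<in> \<O>"
  by (induction k) (simp_all add: one_mem mult_mem)

lemma sum_mem: "(\<And>i. i \<in> A \<Longrightarrow> g i \<in> \<O>) \<Longrightarrow> sum g A \<in> \<O>"
  using of_int_mem[of 0] by (induction A rule: infinite_finite_induct) (auto intro: add_mem)

text \<open>As \<open>\<zeta>\<close> is 1 modulo \<open>1 - \<zeta>\<close>, the value of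
  \<open>f\<close> at \<open>\<zeta>\<close> is congruent to that at 1. The induction is Horner's
  scheme.\<close>

lemma residue_mod_one_minus_root:
  assumes "x \<in> \<O>"
  obtains c :: int and y where "y \<in> \<O>" "x = of_int c + (1 - \<zeta>) * y"
proof -
  have "\<exists>c :: int. \<exists>y\<in>\<O>. poly (map_poly of_int f) \<zeta> = of_int c + (1 - \<zeta>) * y" for f :: "int poly"
  proof (induction f)
    case 0
    show ?case using of_int_mem[of 0] by (auto intro!: exI[of _ 0] bexI[of _ 0])
  next
    case (pCons a f)
    define g where "g = poly (map_poly of_int f) \<zeta>"
    have "g \<in> \<O>" by (auto simp: g_def carrier_cyclotomic_ring)
    obtain c y where "y \<in> \<O>" "g = of_int c + (1 - \<zeta>) * y"
      using pCons.IH by (auto simp: g_def)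
    then have "of_int a + \<zeta> * g = of_int (a + c) + (1 - \<zeta>) * (y - g)"
      by (simp add: algebra_simps)
    moreover have "poly (map_poly of_int (pCons a f)) \<zeta> = of_int a + \<zeta> * g"
      using pCons.hyps by (simp add: map_poly_pCons g_def)
    ultimately show ?case
      using diff_mem[OF \<open>y \<in> \<O>\<close> \<open>g \<in> \<O>\<close>] by metis
  qed
  moreover obtain f :: "int poly" where "x = poly (map_poly of_int f) \<zeta>"
    using assms by (auto simp: carrier_cyclotomic_ring)
  ultimately show ?thesis using that by metis
qed

text \<open>This is \<open>\<Phi>\<^sub>p(1) = p\<close>, reduced modulo \<open>1 - \<zeta>\<close>.\<close>

lemma one_minus_root_dvd_p:
  obtains w where "w \<in> \<O>" "of_nat p = (1 - \<zeta>) * w"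
proof
  \<comment> \<open>The powers of \<open>\<zeta>\<close> sum to 0, so the terms
    \<open>1 - \<zeta> ^ i\<close> sum to \<open>p\<close>; the inner sum is the cofactor of
    \<open>1 - \<zeta>\<close> in each term.\<close>
  let ?w = "\<Sum>i<p. \<Sum>j<i. \<zeta> ^ j"
  show "?w \<in> \<O>" by (intro sum_mem power_mem root_mem)
  have "(1 - \<zeta>) * (\<Sum>i<p. \<zeta> ^ i) = 0"
    using one_diff_power_eq[of \<zeta> p] root_pow by simp
  then have "(\<Sum>i<p. \<zeta> ^ i) = 0" using root_neq_1 by simp
  moreover have "(1 - \<zeta>) * ?w = (\<Sum>i<p. 1 - \<zeta> ^ i)"
    by (simp add: sum_distrib_left one_diff_power_eq)
  ultimately show "of_nat p = (1 - \<zeta>) * ?w" by (simp add: sum_subtractf)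
qed

section \<open>Cosets of ideals\<close>

lemma order_Quot: "Coset.order (cyclotomic_ring p Quot I) = card (coset I ` \<O>)"
  by (auto simp: Coset.order_def FactRing_def A_RCOSETS_def RCOSETS_def r_coset_def coset_def
      intro!: arg_cong[where f = card])

lemma idealD:
  assumes "ideal I (cyclotomic_ring p)"
  shows "I \<subseteq> \<O>" "0 \<in> I" "\<And>x y. x \<in> I \<Longrightarrow> y \<in> I \<Longrightarrow> x + y \<in> I"
    "\<And>a x. a \<in> \<O> \<Longrightarrow> x \<in> I \<Longrightarrow> a * x \<in> I" "\<And>x y. x \<in> I \<Longrightarrow> y \<in> I \<Longrightarrow> x - y \<in> I"
proof -
  interpret ideal I "cyclotomic_ring p" by fact
  show "I \<subseteq> \<O>" "0 \<in> I" and add: "\<And>x y. x \<in> I \<Longrightarrow> y \<in> I \<Longrightarrow> x + y \<in> I"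
    and mult: "\<And>a x. a \<in> \<O> \<Longrightarrow> x \<in> I \<Longrightarrow> a * x \<in> I"
    using a_subset additive_subgroup.zero_closed[OF is_additive_subgroup]
      additive_subgroup.a_closed[OF is_additive_subgroup] I_l_closed by auto
  show "x - y \<in> I" if "x \<in> I" "y \<in> I" for x y
    using add[OF that(1) mult[OF of_int_mem[of "- 1"] that(2)]] by simp
qed

lemma coset_eq_iff:
  assumes "ideal I (cyclotomic_ring p)"
  shows "coset I x = coset I y \<longleftrightarrow> x - y \<in> I"
proof
  assume "coset I x = coset I y"
  moreover have "x \<in> coset I x" using idealD(2)[OF assms] by (force simp: coset_def)
  ultimately show "x - y \<in> I" by (auto simp: coset_def)
next
  assume *: "x - y \<in> I"
  have "h + x = (h + (x - y)) + y" "h + y = (h - (x - y)) + x" for h by simp_all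
  then show "coset I x = coset I y"
    unfolding coset_def using idealD(3,5)[OF assms _ *]
    by (metis (no_types, lifting) image_eqI image_subsetI subset_antisym)
qed

text \<open>The inverse of \<open>\<zeta>\<close> is \<open>\<zeta> ^ (p - 1)\<close>, so
  multiplication by \<open>\<zeta>\<close> maps \<open>I\<close> onto itself.\<close>

lemma root_mult_coset:
  assumes "ideal I (cyclotomic_ring p)"
  shows "(*) \<zeta> ` coset I x = coset I (\<zeta> * x)"
proof -
  have "\<zeta> * (\<zeta> ^ (p - 1) * h) = h" for h
    using root_pow prime_gt_0_nat[OF prime] by (simp add: power_eq_if)
  moreover have "\<zeta> ^ (p - 1) * h \<in> I" "\<zeta> * h \<in> I" if "h \<in> I" for h
    using idealD(4)[OF assms _ that] root_mem power_mem by auto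
  ultimately have "(*) \<zeta> ` I = I" by (metis image_eqI image_subsetI subsetI subset_antisym)
  then have "coset I (\<zeta> * x) = (\<lambda>h. h + \<zeta> * x) ` (*) \<zeta> ` I"
    by (simp add: coset_def)
  then show ?thesis by (simp add: coset_def image_image algebra_simps)
qed

section \<open>The two cases for the index of an ideal\<close>

text \<open>By \<open>inj\<close>, \<open>1 - \<zeta>\<close> is not a zero divisor modulo
  \<open>I\<close>, so only the zero coset is fixed by \<open>\<zeta>\<close>.\<close>

lemma index_cong_1:
  assumes I: "ideal I (cyclotomic_ring p)" and fin: "finite (coset I ` \<O>)"
    and inj: "\<And>x. x \<in> \<O> \<Longrightarrow> (1 - \<zeta>) * x \<in> I \<Longrightarrow> x \<in> I"
  shows "[card (coset I ` \<O>) = 1] (mod p)"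
proof -
  let ?S = "coset I ` \<O>" and ?f = "(`) ((*) \<zeta>)"
  have pow: "(?f ^^ k) C = (*) (\<zeta> ^ k) ` C" for k C
    by (induction k) (simp_all add: image_image mult.assoc)
  have "p dvd card {C \<in> ?S. ?f C \<noteq> C}"
    using root_mem fin
    by (intro prime_dvd_card_non_fixpoints prime)
      (auto simp: root_mult_coset[OF I] mult_mem pow root_pow)
  moreover have "{C \<in> ?S. ?f C = C} = {coset I 0}"
  proof (intro subset_antisym subsetI)
    fix C assume "C \<in> {C \<in> ?S. ?f C = C}"
    then obtain x where x: "x \<in> \<O>" "C = coset I x" "coset I x = coset I (\<zeta> * x)"
      by (auto simp: root_mult_coset[OF I])
    then have "(1 - \<zeta>) * x \<in> I" by (simp add: coset_eq_iff[OF I] algebra_simps)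
    then have "x \<in> I" by (rule inj[OF x(1)])
    then show "C \<in> {coset I 0}" using x(2) by (simp add: coset_eq_iff[OF I])
  qed (use of_int_mem[of 0] root_mult_coset[OF I, of 0] in auto)
  moreover have "card ?S = card {C \<in> ?S. ?f C = C} + card {C \<in> ?S. ?f C \<noteq> C}"
    using fin by (subst card_Un_disjoint[symmetric]) (auto intro: arg_cong[where f = card])
  ultimately have "card ?S = 1 + card {C \<in> ?S. ?f C \<noteq> C}" by simp
  then show ?thesis
    using cong_add[OF cong_refl, of _ 0 p 1] \<open>p dvd _\<close> by (simp add: cong_0_iff)
qed

lemma index_eq_p_mult:
  assumes I: "ideal I (cyclotomic_ring p)"
    and x: "x \<in> \<O>" "(1 - \<zeta>) * x \<in> I" "x \<notin> I"
  obtains J where "ideal J (cyclotomic_ring p)" "I \<subseteq> J"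
    "card (coset I ` \<O>) = p * card (coset J ` \<O>)"
proof
  let ?l = "1 - \<zeta>"
  \<comment> \<open>The ideal quotient of \<open>I\<close> by \<open>?l\<close>. Its multiple by
    \<open>?l\<close> consists of the elements of \<open>I\<close> divisible by \<open>?l\<close>,
    so it remains to see that all of \<open>I\<close> is divisible by \<open>?l\<close>.\<close>
  define J where "J = {y \<in> \<O>. ?l * y \<in> I}"
  note ID = idealD[OF I]
  have l_mem: "?l \<in> \<O>" by (intro diff_mem one_mem root_mem)
  show J: "ideal J (cyclotomic_ring p)"
  proof (rule idealI)
    show "ring (cyclotomic_ring p)" by (rule cring.axioms(1)[OF cring_cyclotomic_ring])
    then interpret ring "cyclotomic_ring p" .
    have uminus: "\<ominus>\<^bsub>cyclotomic_ring p\<^esub> a = - a" if "a \<in> \<O>" for a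
      using that minus_equality[of "- a" a] diff_mem[OF of_int_mem[of 0], of a] by simp
    show "subgroup J (add_monoid (cyclotomic_ring p))"
    proof (rule add.subgroupI)
      show "J \<noteq> {}" using of_int_mem[of 0] ID(2) by (auto simp: J_def)
      fix a assume a: "a \<in> J"
      then show "\<ominus>\<^bsub>cyclotomic_ring p\<^esub> a \<in> J"
        using diff_mem[OF of_int_mem[of 0], of a] ID(5)[OF ID(2), of "?l * a"]
        by (simp add: J_def uminus)
    qed (auto simp: J_def add_mem distrib_left ID(3))
    fix a b assume "a \<in> J" "b \<in> \<O>"
    then have "b * a \<in> J" using ID(4)[of b "?l * a"] by (simp add: J_def mult_mem mult.left_commute)
    then show "b \<otimes>\<^bsub>cyclotomic_ring p\<^esub> a \<in> J" "a \<otimes>\<^bsub>cyclotomic_ring p\<^esub> b \<in> J"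
      by (simp_all add: mult.commute)
  qed
  show "I \<subseteq> J" using ID(1,4) l_mem by (auto simp: J_def)
  \<comment> \<open>An inverse \<open>r\<close> of \<open>?l\<close> modulo \<open>I\<close> would
    carry \<open>?l * x\<close> in \<open>I\<close> back to \<open>x\<close> modulo
    \<open>I\<close>.\<close>
  have proper: "1 \<noteq> i + ?l * r" if "i \<in> I" "r \<in> \<O>" for i r
  proof
    assume "1 = i + ?l * r"
    then have "x = x * i + r * (?l * x)" by (metis distrib_left mult.commute mult.assoc mult_1_right)
    then show False using ID(3,4) that x by metis
  qed
  obtain w where w: "w \<in> \<O>" "of_nat p = ?l * w" by (rule one_minus_root_dvd_p)
  \<comment> \<open>Otherwise Bezout for \<open>c\<close> and \<open>p = ?l * w\<close> would
    produce the excluded representation of 1.\<close>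
  have p_dvd: "int p dvd c" if "of_int c = i + ?l * r" "i \<in> I" "r \<in> \<O>" for c i r
  proof (rule ccontr)
    assume "\<not> int p dvd c"
    then have "coprime (int p) c" using prime by (simp add: prime_imp_coprime)
    then obtain u v where "u * c + v * int p = 1"
      using bezout_int[of c "int p"] by (auto simp: coprime_iff_gcd_eq_1 gcd.commute)
    then have "(1 :: complex) = of_int u * of_int c + of_int v * of_nat p"
      by (metis of_int_1 of_int_add of_int_mult of_int_of_nat_eq)
    also have "\<dots> = of_int u * i + ?l * (of_int u * r + of_int v * w)"
      by (simp add: that(1) w(2) algebra_simps)
    finally show False
      using proper ID(4) that(2,3) w(1) by (metis add_mem mult_mem of_int_mem)
  qed
  have I_eq: "I = (*) ?l ` J"
  proof (intro subset_antisym subsetI)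
    fix i assume i: "i \<in> I"
    then obtain c y where cy: "y \<in> \<O>" "i = of_int c + ?l * y"
      using residue_mod_one_minus_root ID(1) by blast
    \<comment> \<open>The integer residue of \<open>i\<close> modulo \<open>?l\<close> is itself of
      the form treated in \<open>p_dvd\<close>; being a multiple of \<open>p\<close>, it is a
      multiple of \<open>?l\<close>.\<close>
    have "int p dvd c"
      using p_dvd[of c i "0 - y"] i cy diff_mem[OF of_int_mem[of 0], of y] by simp
    then obtain k where "c = int p * k" by blast
    then have "i = ?l * (of_int k * w + y)" using cy(2) w(2) by (simp add: algebra_simps)
    moreover have "of_int k * w + y \<in> \<O>" using w cy by (intro add_mem mult_mem of_int_mem)
    ultimately show "i \<in> (*) ?l ` J" using i by (auto simp: J_def)
  qed (auto simp: J_def)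
  have h: "(\<lambda>z. of_nat c + ?l * z) ` coset J y = coset I (of_nat c + ?l * y)" for c y
    by (simp add: coset_def I_eq image_image algebra_simps)
  \<comment> \<open>The factor \<open>p\<close> counts residues \<open>c\<close> modulo
    \<open>?l\<close>, and \<open>C\<close> accounts for cosets of \<open>?l\<close> times
    \<open>J\<close> among the multiples of \<open>?l\<close>. Taking images of whole cosets avoids
    choosing representatives.\<close>
  have "bij_betw (\<lambda>(c, C). (\<lambda>z. of_nat c + ?l * z) ` C) ({..<p} \<times> coset J ` \<O>) (coset I ` \<O>)"
    unfolding bij_betw_def
  proof (intro conjI)
    show "inj_on (\<lambda>(c, C). (\<lambda>z. of_nat c + ?l * z) ` C) ({..<p} \<times> coset J ` \<O>)"
    proof (rule inj_onI, clarify)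
      fix c c' y y' assume *: "c < p" "c' < p" "y \<in> \<O>" "y' \<in> \<O>"
        and "(\<lambda>z. of_nat c + ?l * z) ` coset J y = (\<lambda>z. of_nat c' + ?l * z) ` coset J y'"
      then have mem: "of_nat c + ?l * y - (of_nat c' + ?l * y') \<in> I"
        by (simp add: h coset_eq_iff[OF I])
      have "int p dvd int c - int c'"
        by (rule p_dvd[OF _ mem, of _ "y' - y"]) (simp_all add: * diff_mem algebra_simps)
      then have "int c mod int p = int c' mod int p" by (simp add: mod_eq_dvd_iff)
      then have "c = c'" using * by simp
      then have "?l * (y - y') \<in> I" using mem by (simp add: algebra_simps)
      then have "y - y' \<in> J" using * by (simp add: J_def diff_mem)
      then show "c = c' \<and> coset J y = coset J y'" using \<open>c = c'\<close> by (simp add: coset_eq_iff[OF J])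
    qed
    show "(\<lambda>(c, C). (\<lambda>z. of_nat c + ?l * z) ` C) ` ({..<p} \<times> coset J ` \<O>) = coset I ` \<O>"
    proof (intro subset_antisym subsetI)
      fix C assume "C \<in> coset I ` \<O>"
      then obtain v where v: "v \<in> \<O>" "C = coset I v" by blast
      then obtain c y where cy: "y \<in> \<O>" "v = of_int c + ?l * y"
        using residue_mod_one_minus_root by blast
      \<comment> \<open>Reducing \<open>c\<close> modulo \<open>p\<close> changes it by a multiple
        of \<open>p = ?l * w\<close>, which the multiple of \<open>?l\<close> absorbs.\<close>
      define r where "r = nat (c mod int p)"
      have p0: "int p > 0" using prime_gt_0_nat[OF prime] by simp
      have "c = int r + int p * (c div int p)" using p0 by (simp add: r_def)
      then have "of_int c = of_nat r + of_nat p * (of_int (c div int p) :: complex)"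
        by (metis of_int_add of_int_mult of_int_of_nat_eq)
      then have "v = of_nat r + ?l * (w * of_int (c div int p) + y)"
        unfolding cy(2) by (simp add: w(2) algebra_simps)
      moreover have "r < p" using p0 by (simp add: r_def nat_less_iff)
      moreover have "w * of_int (c div int p) + y \<in> \<O>" using w cy by (intro add_mem mult_mem of_int_mem)
      ultimately show "C \<in> (\<lambda>(c, C). (\<lambda>z. of_nat c + ?l * z) ` C) ` ({..<p} \<times> coset J ` \<O>)"
        using v(2) h by (intro image_eqI[of _ _ "(r, coset J (w * of_int (c div int p) + y))"]) auto
    next
      fix C assume "C \<in> (\<lambda>(c, C). (\<lambda>z. of_nat c + ?l * z) ` C) ` ({..<p} \<times> coset J ` \<O>)"
      then obtain c y where "y \<in> \<O>" "C = coset I (of_nat c + ?l * y)" by (auto simp: h)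
      then show "C \<in> coset I ` \<O>"
        using add_mem[OF of_int_mem[of "int c"] mult_mem[OF l_mem]] by auto
    qed
  qed
  then show "card (coset I ` \<O>) = p * card (coset J ` \<O>)"
    by (simp add: bij_betw_same_card[symmetric] card_cartesian_product)
qed

text \<open>Positivity of \<open>m\<close> gives the finite index required in the first case, and
  makes the index of \<open>J\<close> positive in the second.\<close>

lemma ideal_norms_cases:
  assumes "m \<in> ideal_norms p"
  obtains "[m = 1] (mod p)" | k where "k \<in> ideal_norms p" "m = p * k"
proof -
  obtain I where I: "ideal I (cyclotomic_ring p)" "I \<noteq> {0}" and m: "m > 0" "m = card (coset I ` \<O>)"
    using assms by (auto simp: ideal_norms_def order_Quot)
  show ?thesis
  proof (cases "\<forall>x\<in>\<O>. (1 - \<zeta>) * x \<in> I \<longrightarrow> x \<in> I")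
    case True
    then show ?thesis using that(1) index_cong_1[OF I(1)] m card_ge_0_finite by auto
  next
    case False
    then obtain J where J: "ideal J (cyclotomic_ring p)" "I \<subseteq> J"
      "card (coset I ` \<O>) = p * card (coset J ` \<O>)"
      using index_eq_p_mult[OF I(1)] by metis
    have "J \<noteq> {0}" using I J(2) idealD(2)[OF I(1)] by auto
    then have "card (coset J ` \<O>) \<in> ideal_norms p"
      using J m by (auto simp: ideal_norms_def order_Quot)
    then show ?thesis using that(2) J(3) m(2) by simp
  qed
qed

end

section \<open>Dividing a representation by \<open>p\<close>\<close>

text \<open>Isolates the summands equal to \<open>q ^ 0\<close>, the only ones from which
  \<open>q\<close> cannot be factored out.\<close>

lemma sum_list_powers_eq:
  "(\<Sum>b\<leftarrow>bs. q ^ b) =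
     of_nat (count_list bs 0) + q * (\<Sum>b\<leftarrow>filter (\<lambda>b. b \<noteq> 0) bs. q ^ (b - 1))"
  for q :: "'a :: comm_semiring_1"
proof (induction bs)
  case (Cons b bs)
  then show ?case by (cases b) (simp_all add: algebra_simps)
qed simp

lemma sum_norm_and_powers_divide:
  assumes "prime p" "p \<ge> 3" "sum_norm_and_powers p (int p * n)"
  shows "sum_norm_and_powers p n"
proof -
  interpret prime_cyclotomic p by unfold_locales fact
  obtain m bs where m: "m \<in> ideal_norms p" and len: "length bs \<le> p - 2"
    and eq: "int p * n = int m + (\<Sum>b\<leftarrow>bs. int p ^ b)"
    using assms(3) by (auto simp: sum_norm_and_powers_def)
  define t where "t = count_list bs 0"
  define bs' where "bs' = map (\<lambda>b. b - 1) (filter (\<lambda>b. b \<noteq> 0) bs)"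
  have len': "length bs' \<le> p - 2"
    unfolding bs'_def length_map by (rule le_trans[OF length_filter_le len])
  have "t \<le> p - 2"
    using len count_le_length[of bs 0] by (simp add: t_def)
  have eq': "int p * n = int m + int t + int p * (\<Sum>b\<leftarrow>bs'. int p ^ b)"
    using eq sum_list_powers_eq[of "int p" bs] by (simp add: t_def bs'_def comp_def)
  then have "int p dvd int (m + t)"
    by (metis add_diff_cancel_right' dvd_diff dvd_triv_left of_nat_add)
  then have dvd: "p dvd m + t" by (simp only: int_dvd_int_iff)
  show ?thesis
    using m
  proof (cases rule: ideal_norms_cases)
    case 1
    then have "[m + t = 1 + t] (mod p)" by (rule cong_add[OF _ cong_refl])
    then have "p dvd 1 + t" using dvd by (metis cong_0_iff cong_sym cong_trans)
    \<comment> \<open>Here the bound \<open>p - 2\<close> is decisive: \<open>1 + t\<close> lies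
      between 1 and \<open>p - 1\<close>.\<close>
    then show ?thesis using \<open>t \<le> p - 2\<close> \<open>p \<ge> 3\<close> by (auto dest!: dvd_imp_le)
  next
    case (2 k)
    then have "p dvd t" using dvd by (simp add: dvd_add_right_iff)
    then have "t = 0" using \<open>t \<le> p - 2\<close> \<open>p \<ge> 3\<close> by (cases "t = 0") (auto dest!: dvd_imp_le)
    then have "int p * n = int p * (int k + (\<Sum>b\<leftarrow>bs'. int p ^ b))"
      using eq' 2(2) by (simp add: algebra_simps)
    then have "n = int k + (\<Sum>b\<leftarrow>bs'. int p ^ b)" using \<open>p \<ge> 3\<close> by simp
    then show ?thesis using 2(1) len' by (auto simp: sum_norm_and_powers_def)
  qed
qed

theorem lemma6:
  fixes p :: nat and n :: int
  assumes "prime p" and "p \<ge> 3"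
    and "\<not> sum_norm_and_powers p n"
  shows "\<forall>a :: nat. \<not> sum_norm_and_powers p (int p ^ a * n)"
proof
  fix a
  show "\<not> sum_norm_and_powers p (int p ^ a * n)"
  proof (induction a)
    case (Suc a)
    then show ?case
      using sum_norm_and_powers_divide[OF assms(1,2), of "int p ^ a * n"] by (auto simp: mult.assoc)
  qed (simp add: assms(3))
qed

end
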